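(* Let $\mathcal{B}$ be a scroll matrix of linear forms in $S=K[V]$, let $\mathcal{M}$ be the ideal generated by the $2\times2$ minors of $\mathcal{B}$, and suppose that $\mathcal{M}\subset(\Delta)$ for a linear subspace $\Delta\subset V$. Then at least one of the following holds. 1. All the blocks of $\mathcal{B}$ are generic. In this case, if $\mathcal{B}=\begin{pmatrix}L_{1,0}&\dots&L_{r,0}\\L_{1,1}&\dots&L_{r,1}\end{pmatrix}$ has $r\ge2$ columns, one of the following holds: (a) up to permutation of the two lines (rows) of $\mathcal{B}$, there is some $i$ with $L_{i,0}\in\Delta$, $L_{i,1}\notin\Delta$, and in this case all elements of the first line are in $\Delta$; (b) there is some $i$ with $L_{i,0},L_{i,1}\in\Delta$; in this case the matrix obtained from $\mathcal{B}$ by deleting column $i$ is still a generic matrix, with $r-1$ columns, and if $r-1\ge2$ the same list (a)–(d) of alternatives applies to it recursively; (c) there is a nonzero constant $\alpha\in K$ and, for every $i=1,\dots,r$, a nonzero linear form $H_i\notin\Delta$ such that $\{L_{i,0}-H_i,\;L_{i,1}-\alpha H_i\}\subset\Delta$; (d) there are linear forms $H_1,H_2\notin\Delta$ and, for every $i=1,\dots,r$, a nonzero constant $\alpha_i\in K$ such that $\{L_{i,0}-\alpha_iH_1,\;L_{i,1}-\alpha_iH_2\}\subset\Delta$. 2. The entries of exactly one line (row) of $\mathcal{B}$ are in $\Delta$. 3. There is a non generic block $\mathcal{B}_i$ of $\mathcal{B}$ all of whose entries are in $\Delta$; in this case the matrix $\mathcal{B}'$ obtained from $\mathcal{B}$ by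 deleting $\mathcal{B}_i$ is a scroll matrix with fewer columns than $\mathcal{B}$, and the present alternatives 1–4 apply recursively to $\mathcal{B}'$. 4. There is a non generic block of $\mathcal{B}$, and no entry of a non generic block of $\mathcal{B}$ is in $\Delta$. In this case there is a nonzero constant $\alpha\in K$ such that: - for every non generic block $\mathcal{B}_i$ there is a linear form $H_i\notin\Delta$ such that $\{L_{i,0}-H_i,\;L_{i,1}-\alpha H_i,\dots,L_{i,c_i+1}-\alpha^{c_i+1}H_i\}\subset\Delta$; - for every generic block $\mathcal{B}_i$ there is a linear form $H_i$, with $H_i=0$ or $H_i\notin\Delta$, such that $\{L_{i,0}-H_i,\;L_{i,1}-\alpha H_i\}\subset\Delta$.
   Context: $K$ is a field, $V$ is a finite-dimensional $K$-vector space, $S=K[V]$ is the polynomial ring whose space of linear forms is $V$, and $(\Delta)$ denotes the ideal of $S$ generated by a subspace $\Delta\subset V$ (a linear ideal). A scroll matrix is a $2$-row matrix obtained by placing side by side blocks $$\mathcal{B}_i=\begin{pmatrix}L_{i,0}&L_{i,1}&\dots&L_{i,c_i}\\ L_{i,1}&L_{i,2}&\dots&L_{i,c_i+1}\end{pmatrix},\quad i=1,\dots,r,\ c_i\ge0,$$ where all the linear forms $L_{i,j}$ ($1\le i\le r$, $0\le j\le c_i+1$) are linearly independent. The block $\mathcal{B}_i$ is generic if $c_i=0$ and non generic if $c_i>0$. A generic matrix is a scroll matrix all of whose blocks are generic. *)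

theory Defs
  imports Complex_Main "HOL-Library.Poly_Mapping"
begin

section \<open>Polynomials, linear forms and ideals\<close>

text \<open>
  Polynomials over \<open>'k\<close> in indeterminates \<open>'x\<close>: finitely supported maps from exponent
  vectors to coefficients, with the convolution product of \<^theory>\<open>HOL-Library.Poly_Mapping\<close>.
  With \<open>'x\<close> finite this is \<open>K[V]\<close> for \<open>V\<close> of dimension \<open>CARD('x)\<close>, where a basis of \<open>V\<close> has
  been chosen.
\<close>

type_synonym ('x, 'k) mpoly = "('x \<Rightarrow>\<^sub>0 nat) \<Rightarrow>\<^sub>0 'k"

definition indet :: "'x \<Rightarrow> ('x, 'k::field) mpoly"
  where "indet x = Poly_Mapping.single (Poly_Mapping.single x 1) 1"

definition pscale :: "'k::field \<Rightarrow> ('x, 'k) mpoly \<Rightarrow> ('x, 'k) mpoly"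
  where "pscale c p = Poly_Mapping.single 0 c * p"

interpretation mpoly: vector_space "pscale :: 'k::field \<Rightarrow> ('x, 'k) mpoly \<Rightarrow> ('x, 'k) mpoly"
  by unfold_locales
    (simp_all add: pscale_def distrib_left distrib_right single_add mult_single single_one
      flip: mult.assoc)

definition linear_forms :: "('x, 'k::field) mpoly set"
  where "linear_forms = mpoly.span (range indet)"

lemma module_mult: "module ((*) :: 'a::comm_ring_1 \<Rightarrow> 'a \<Rightarrow> 'a)"
  by unfold_locales (simp_all add: algebra_simps)

text \<open>The ideal generated by \<open>A\<close>: the submodule of the ring, as a module over itself,
  generated by \<open>A\<close>.\<close>

definition ideal_span :: "'a::comm_ring_1 set \<Rightarrow> 'a set"
  where "ideal_span A = module.span (*) A"

section \<open>Scroll matrices\<close>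

text \<open>
  A block with rows \<open>L\<^sub>0, \<dots>, L\<^sub>c\<close> and \<open>L\<^sub>1, \<dots>, L\<^bsub>c+1\<^esub>\<close> is represented by the list
  \<open>[L\<^sub>0, \<dots>, L\<^bsub>c+1\<^esub>]\<close>, so that \<open>c = length B - 2\<close>; a matrix is the list of its blocks.
\<close>

definition generic_block :: "'a list \<Rightarrow> bool"
  where "generic_block B \<longleftrightarrow> length B = 2"

definition nongeneric_block :: "'a list \<Rightarrow> bool"
  where "nongeneric_block B \<longleftrightarrow> length B > 2"

text \<open>
  The empty list of blocks is admitted: deleting the only block of a matrix leaves it.
\<close>

definition scroll_matrix :: "('x, 'k::field) mpoly list list \<Rightarrow> bool"
  where "scroll_matrix Bs \<longleftrightarrow>
    (\<forall>B\<in>set Bs. length B \<ge> 2) \<and>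
    set (concat Bs) \<subseteq> linear_forms \<and>
    distinct (concat Bs) \<and> mpoly.independent (set (concat Bs))"

definition generic_matrix :: "('x, 'k::field) mpoly list list \<Rightarrow> bool"
  where "generic_matrix Bs \<longleftrightarrow> scroll_matrix Bs \<and> (\<forall>B\<in>set Bs. generic_block B)"

definition first_row :: "'a list list \<Rightarrow> 'a list"
  where "first_row Bs = concat (map butlast Bs)"

definition second_row :: "'a list list \<Rightarrow> 'a list"
  where "second_row Bs = concat (map tl Bs)"

definition columns :: "'a list list \<Rightarrow> nat"
  where "columns Bs = length (first_row Bs)"

definition minors :: "'a::comm_ring_1 list list \<Rightarrow> 'a set"
  where "minors Bs =
    {first_row Bs ! j * second_row Bs ! k - first_row Bs ! k * second_row Bs ! j | j k.
      j < k \<and> k < columns Bs}"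

definition delete_block :: "nat \<Rightarrow> 'a list list \<Rightarrow> 'a list list"
  where "delete_block i Bs = take i Bs @ drop (Suc i) Bs"

section \<open>The alternatives\<close>

text \<open>
  For generic matrices; \<open>Bs ! i ! 0\<close> and \<open>Bs ! i ! 1\<close> are the two entries of column \<open>i\<close>, and
  \<open>map rev Bs\<close> is the matrix with its two rows exchanged. Since each recursive call deletes a
  column, the inductive predicate is the recursively defined disjunction of its rules.
\<close>

inductive generic_alternatives ::
  "('x, 'k::field) mpoly set \<Rightarrow> ('x, 'k) mpoly list list \<Rightarrow> bool"
  for \<Delta> where
  line_in:
    "\<lbrakk>Cs = Bs \<or> Cs = map rev Bs;
      \<exists>i<length Cs. Cs ! i ! 0 \<in> \<Delta> \<and> Cs ! i ! 1 \<notin> \<Delta>;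
      \<forall>i<length Cs. Cs ! i ! 0 \<in> \<Delta>\<rbrakk>
     \<Longrightarrow> generic_alternatives \<Delta> Bs"
| column_in:
    "\<lbrakk>i < length Bs; Bs ! i ! 0 \<in> \<Delta>; Bs ! i ! 1 \<in> \<Delta>;
      generic_matrix (delete_block i Bs);
      columns (delete_block i Bs) = columns Bs - 1;
      columns (delete_block i Bs) \<ge> 2 \<longrightarrow> generic_alternatives \<Delta> (delete_block i Bs)\<rbrakk>
     \<Longrightarrow> generic_alternatives \<Delta> Bs"
| proportional_rows:
    "\<lbrakk>\<alpha> \<noteq> 0;
      \<forall>i<length Bs. \<exists>H\<in>linear_forms. H \<noteq> 0 \<and> H \<notin> \<Delta> \<and>
        {Bs ! i ! 0 - H, Bs ! i ! 1 - pscale \<alpha> H} \<subseteq> \<Delta>\<rbrakk>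
     \<Longrightarrow> generic_alternatives \<Delta> Bs"
| proportional_columns:
    "\<lbrakk>H\<^sub>1 \<in> linear_forms; H\<^sub>2 \<in> linear_forms; H\<^sub>1 \<notin> \<Delta>; H\<^sub>2 \<notin> \<Delta>;
      \<forall>i<length Bs. \<exists>\<alpha>. \<alpha> \<noteq> 0 \<and>
        {Bs ! i ! 0 - pscale \<alpha> H\<^sub>1, Bs ! i ! 1 - pscale \<alpha> H\<^sub>2} \<subseteq> \<Delta>\<rbrakk>
     \<Longrightarrow> generic_alternatives \<Delta> Bs"

inductive scroll_alternatives ::
  "('x, 'k::field) mpoly set \<Rightarrow> ('x, 'k) mpoly list list \<Rightarrow> bool"
  for \<Delta> where
  all_generic:
    "\<lbrakk>\<forall>B\<in>set Bs. generic_block B;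
      columns Bs \<ge> 2 \<longrightarrow> generic_alternatives \<Delta> Bs\<rbrakk>
     \<Longrightarrow> scroll_alternatives \<Delta> Bs"
| one_line_in:
    "(set (first_row Bs) \<subseteq> \<Delta>) \<noteq> (set (second_row Bs) \<subseteq> \<Delta>)
     \<Longrightarrow> scroll_alternatives \<Delta> Bs"
| block_in:
    "\<lbrakk>i < length Bs; nongeneric_block (Bs ! i); set (Bs ! i) \<subseteq> \<Delta>;
      scroll_matrix (delete_block i Bs);
      columns (delete_block i Bs) < columns Bs;
      scroll_alternatives \<Delta> (delete_block i Bs)\<rbrakk>
     \<Longrightarrow> scroll_alternatives \<Delta> Bs"
| no_nongeneric_entry_in:
    "\<lbrakk>\<exists>B\<in>set Bs. nongeneric_block B;
      \<forall>B\<in>set Bs. nongeneric_block B \<longrightarrow> (\<forall>L\<in>set B. L \<notin> \<Delta>);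
      \<alpha> \<noteq> 0;
      \<forall>B\<in>set Bs. nongeneric_block B \<longrightarrow>
        (\<exists>H\<in>linear_forms. H \<notin> \<Delta> \<and> (\<forall>j<length B. B ! j - pscale (\<alpha> ^ j) H \<in> \<Delta>));
      \<forall>B\<in>set Bs. generic_block B \<longrightarrow>
        (\<exists>H\<in>linear_forms. (H = 0 \<or> H \<notin> \<Delta>) \<and>
          {B ! 0 - H, B ! 1 - pscale \<alpha> H} \<subseteq> \<Delta>)\<rbrakk>
     \<Longrightarrow> scroll_alternatives \<Delta> Bs"

end

theory Submission
  imports Defs
begin

text \<open>
  Modulo \<open>(\<Delta>)\<close> the ring \<open>S\<close> becomes the polynomial ring \<open>K[V/\<Delta>]\<close>, a domain, and the hypothesis says
  that over it the matrix has rank at most one: any two columns \<open>(a, b)\<close> and \<open>(c, d)\<close> satisfy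
  \<open>ad = cb\<close>. A column with exactly one vanishing entry therefore kills a whole row. If no
  entry of \<open>(a, b)\<close> vanishes, unique factorization of the quadric \<open>ad = cb\<close> leaves two
  possibilities: \<open>b = \<alpha>a\<close>, and then \<open>d = \<alpha>c\<close> for every other column, or \<open>(c, d) = \<mu>(a, b)\<close> with a
  scalar \<open>\<mu>\<close>. In a non generic block the second entry of one column is the first entry of the
  next, so either possibility makes \<open>L\<^sub>1\<close> a multiple \<open>\<alpha>L\<^sub>0\<close>, the block a geometric progression of
  ratio \<open>\<alpha>\<close>, and \<open>\<alpha>\<close> the ratio of the two rows of the entire matrix. Vanishing columns and
  blocks are removed by induction on the number of blocks.

  All factorization arguments come from one fact, \<open>linear_ideal_prime\<close>: if a product of two
  linear forms lies in \<open>(\<Delta>)\<close>, one of the factors lies in \<open>\<Delta>\<close>. Unique factorization itself is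
  replaced by applying it to \<open>\<Delta>\<close> and to \<open>\<Delta> + Ka\<close> (\<open>minor_proportional\<close>). The quotient ring is
  avoided as well: \<open>(\<Delta>)\<close> vanishes at the points of the dual space of \<open>V\<close> that annihilate \<open>\<Delta>\<close>,
  and two linear forms outside \<open>\<Delta>\<close> are both nonzero at some such point.
\<close>

section \<open>Ideals\<close>

lemma ideal_span_base: "x \<in> A \<Longrightarrow> x \<in> ideal_span A"
  unfolding ideal_span_def by (rule module.span_base[OF module_mult])

lemma ideal_span_add: "x \<in> ideal_span A \<Longrightarrow> y \<in> ideal_span A \<Longrightarrow> x + y \<in> ideal_span A"
  unfolding ideal_span_def by (rule module.span_add[OF module_mult])

lemma ideal_span_diff: "x \<in> ideal_span A \<Longrightarrow> y \<in> ideal_span A \<Longrightarrow> x - y \<in> ideal_span A"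
  unfolding ideal_span_def by (rule module.span_diff[OF module_mult])

lemma ideal_span_mult: "x \<in> ideal_span A \<Longrightarrow> r * x \<in> ideal_span A"
  unfolding ideal_span_def by (rule module.span_scale[OF module_mult])

lemma ideal_span_mult_right: "x \<in> ideal_span A \<Longrightarrow> x * r \<in> ideal_span A"
  using ideal_span_mult[of x A r] by (simp add: mult.commute)

lemma ideal_span_mono: "A \<subseteq> B \<Longrightarrow> ideal_span A \<subseteq> ideal_span B"
  unfolding ideal_span_def by (rule module.span_mono[OF module_mult])

lemma ideal_span_zero: "0 \<in> ideal_span A"
  unfolding ideal_span_def by (rule module.span_zero[OF module_mult])

section \<open>Evaluation at a point\<close>

definition eval_monom :: "('x::finite \<Rightarrow> 'k::field) \<Rightarrow> ('x \<Rightarrow>\<^sub>0 nat) \<Rightarrow> 'k"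
  where "eval_monom a m = (\<Prod>x\<in>UNIV. a x ^ Poly_Mapping.lookup m x)"

definition eval_at :: "('x::finite \<Rightarrow> 'k::field) \<Rightarrow> ('x, 'k) mpoly \<Rightarrow> 'k"
  where "eval_at a p = (\<Sum>m\<in>Poly_Mapping.keys p. Poly_Mapping.lookup p m * eval_monom a m)"

lemma eval_at_superset:
  assumes "finite M" "Poly_Mapping.keys p \<subseteq> M"
  shows "eval_at a p = (\<Sum>m\<in>M. Poly_Mapping.lookup p m * eval_monom a m)"
  unfolding eval_at_def using assms
  by (intro sum.mono_neutral_left) (auto simp: in_keys_iff)

lemma eval_at_add: "eval_at a (p + q) = eval_at a p + eval_at a q"
proof -
  have "Poly_Mapping.keys (p + q) \<subseteq> Poly_Mapping.keys p \<union> Poly_Mapping.keys q" by (rule Poly_Mapping.keys_add)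
  then show ?thesis
    by (simp add: eval_at_superset[where M = "Poly_Mapping.keys p \<union> Poly_Mapping.keys q"] lookup_add
        distrib_right sum.distrib)
qed

lemma eval_at_zero [simp]: "eval_at a 0 = 0"
  by (simp add: eval_at_def)

lemma eval_at_single [simp]: "eval_at a (Poly_Mapping.single m c) = c * eval_monom a m"
  by (simp add: eval_at_superset[where M = "{m}"])

lemma eval_monom_add: "eval_monom a (m + n) = eval_monom a m * eval_monom a n"
  by (simp add: eval_monom_def lookup_add power_add prod.distrib)

lemma mpoly_add_induct [case_names zero single add]:
  assumes "P 0" "\<And>m c. P (Poly_Mapping.single m c)" "\<And>p q. P p \<Longrightarrow> P q \<Longrightarrow> P (p + q)"
  shows "P (p :: ('x, 'k::field) mpoly)"
proof (induction p rule: update_induct)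
  case const
  then show ?case by (rule assms(1))
next
  case (update f m c)
  have "Poly_Mapping.update m c f = f + Poly_Mapping.single m c"
    using update(1)
    by (intro poly_mapping_eqI) (auto simp: lookup_update lookup_add lookup_single in_keys_iff)
  then show ?case using update assms by simp
qed

lemma eval_at_mult: "eval_at a (p * q) = eval_at a p * eval_at a q"
proof (induction p rule: mpoly_add_induct)
  case (single m c)
  show ?case
    by (induction q rule: mpoly_add_induct)
      (simp_all add: mult_single eval_monom_add distrib_left eval_at_add)
qed (simp_all add: distrib_right eval_at_add)

lemma eval_at_pscale: "eval_at a (pscale c p) = c * eval_at a p"
  by (simp add: pscale_def eval_at_mult eval_monom_def)

lemma eval_at_indet: "eval_at a (indet x) = a x"
proof -
  have "eval_monom a (Poly_Mapping.single x 1) = (\<Prod>y\<in>UNIV. if y = x then a y else 1)"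
    unfolding eval_monom_def by (rule prod.cong) (auto simp: lookup_single)
  then show ?thesis by (simp add: indet_def)
qed

lemma eval_at_ideal_span:
  assumes "\<And>d. d \<in> D \<Longrightarrow> eval_at a d = 0" "p \<in> ideal_span D"
  shows "eval_at a p = 0"
  using assms(2) unfolding ideal_span_def
proof (induction rule: module.span_induct_alt[OF module_mult, consumes 1])
  case 1
  show ?case by simp
next
  case (2 c x y)
  then show ?case using assms(1) by (simp add: eval_at_add eval_at_mult)
qed

text \<open>
  A linear functional on \<open>V\<close> extends to the ring homomorphism \<open>S \<rightarrow> K\<close> that evaluates at the
  point whose coordinates are its values on the indeterminates.
\<close>

lemma linear_functional_eq_eval_at:
  assumes "Vector_Spaces.linear pscale (*) f" "l \<in> linear_forms"
  shows "f l = eval_at (\<lambda>x. f (indet x)) l"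
  using assms(2) unfolding linear_forms_def
proof (induction rule: mpoly.span_induct_alt)
  case base
  show ?case using Vector_Spaces.linear.axioms(3)[OF assms(1)] module_hom.zero by fastforce
next
  case (step c x y)
  interpret f: Vector_Spaces.linear pscale "(*)" f by fact
  from step show ?case
    by (auto simp: f.add f.scale eval_at_add eval_at_pscale eval_at_indet)
qed

lemma separating_functional:
  fixes \<Delta> :: "('x, 'k::field) mpoly set"
  assumes "mpoly.subspace \<Delta>" "p \<notin> \<Delta>"
  obtains f :: "('x, 'k) mpoly \<Rightarrow> 'k"
  where "Vector_Spaces.linear pscale (*) f" "\<And>d. d \<in> \<Delta> \<Longrightarrow> f d = 0" "f p = 1"
proof -
  interpret vector_space_pair "pscale :: 'k \<Rightarrow> ('x, 'k) mpoly \<Rightarrow> _" "(*) :: 'k \<Rightarrow> 'k \<Rightarrow> 'k"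
    by unfold_locales (simp_all add: algebra_simps)
  obtain B where B: "B \<subseteq> \<Delta>" "mpoly.independent B" "\<Delta> \<subseteq> mpoly.span B"
    using mpoly.basis_exists by metis
  have "mpoly.span B \<subseteq> \<Delta>"
    using B(1) assms(1) by (rule mpoly.span_minimal)
  with assms(2) have p: "p \<notin> mpoly.span B" by auto
  with B(2) have "mpoly.independent (insert p B)"
    by (rule mpoly.independent_insertI[rotated])
  then obtain f where f: "Vector_Spaces.linear pscale (*) f" "\<forall>b\<in>insert p B. f b = (if b = p then 1 else 0)"
    using linear_independent_extend[of "insert p B" "\<lambda>b. if b = p then 1 else 0"] by metis
  interpret f: Vector_Spaces.linear pscale "(*)" f by fact
  have "f b = 0" if "b \<in> B" for b
    using that f(2) p mpoly.span_base[of p B] by auto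
  then have "f d = 0" if "d \<in> \<Delta>" for d
    using f.eq_0_on_span that B(3) by blast
  with f show ?thesis using that[of f] by simp
qed

section \<open>Linear ideals are prime on linear forms\<close>

text \<open>
  If \<open>p\<close> and \<open>q\<close> lie outside \<open>\<Delta>\<close>, the functionals that vanish on \<open>\<Delta>\<close> and at \<open>p\<close> form a proper
  subspace of the annihilator of \<open>\<Delta>\<close>, and so do those that vanish at \<open>q\<close>. A vector space is never
  the union of two proper subspaces, whatever the field, so some functional avoids both; the
  corresponding evaluation kills \<open>(\<Delta>)\<close> but not \<open>pq\<close>.
\<close>

lemma linear_ideal_prime:
  fixes \<Delta> :: "('x::finite, 'k::field) mpoly set"
  assumes \<Delta>: "\<Delta> \<subseteq> linear_forms" "mpoly.subspace \<Delta>"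
    and pq: "p \<in> linear_forms" "q \<in> linear_forms" "p * q \<in> ideal_span \<Delta>"
  shows "p \<in> \<Delta> \<or> q \<in> \<Delta>"
proof (rule ccontr)
  assume *: "\<not> (p \<in> \<Delta> \<or> q \<in> \<Delta>)"
  have no: False
    if "Vector_Spaces.linear pscale (*) h" "\<And>d. d \<in> \<Delta> \<Longrightarrow> h d = 0" "h p \<noteq> 0" "h q \<noteq> 0"
    for h :: "('x, 'k) mpoly \<Rightarrow> 'k"
  proof -
    let ?a = "\<lambda>x. h (indet x)"
    have ev: "l \<in> linear_forms \<Longrightarrow> eval_at ?a l = h l" for l
      using linear_functional_eq_eval_at[OF that(1)] by simp
    have "eval_at ?a (p * q) = 0"
    proof (rule eval_at_ideal_span[OF _ pq(3)])
      show "eval_at ?a d = 0" if "d \<in> \<Delta>" for d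
        using that \<Delta>(1) ev \<open>\<And>d. d \<in> \<Delta> \<Longrightarrow> h d = 0\<close> by auto
    qed
    then show False using pq(1,2) that(3,4) by (simp add: eval_at_mult ev)
  qed
  obtain f where f: "Vector_Spaces.linear pscale (*) f" "\<And>d. d \<in> \<Delta> \<Longrightarrow> f d = 0" "f p = 1"
    using separating_functional \<Delta>(2) * by metis
  obtain g where g: "Vector_Spaces.linear pscale (*) g" "\<And>d. d \<in> \<Delta> \<Longrightarrow> g d = 0" "g q = 1"
    using separating_functional \<Delta>(2) * by metis
  interpret vector_space_pair "pscale :: 'k \<Rightarrow> ('x, 'k) mpoly \<Rightarrow> _" "(*) :: 'k \<Rightarrow> 'k \<Rightarrow> 'k"
    by unfold_locales (simp_all add: algebra_simps)
  have fg: "Vector_Spaces.linear pscale (*) (\<lambda>v. f v + g v)"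
    using f(1) g(1) by (rule linear_compose_add)
  \<comment> \<open>One of \<open>f\<close>, \<open>g\<close>, \<open>f + g\<close> is nonzero at both.\<close>
  show False
  proof (cases "f q = 0 \<and> g p = 0")
    case True
    then show False using no[OF fg] f g by simp
  next
    case False
    then show False using no[OF f(1,2)] no[OF g(1,2)] f(3) g(3) by auto
  qed
qed

lemma pscale_linear_forms: "p \<in> linear_forms \<Longrightarrow> pscale c p \<in> linear_forms"
  unfolding linear_forms_def by (rule mpoly.span_scale)

lemma diff_linear_forms: "p \<in> linear_forms \<Longrightarrow> q \<in> linear_forms \<Longrightarrow> p - q \<in> linear_forms"
  unfolding linear_forms_def by (rule mpoly.span_diff)

lemma pscale_mult: "pscale c p * q = pscale c (p * q)" "p * pscale c q = pscale c (p * q)"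
  by (simp_all add: pscale_def mult_ac)

section \<open>Two columns that are proportional modulo a linear ideal\<close>

locale linear_ideal =
  fixes \<Delta> :: "('x::finite, 'k::field) mpoly set"
  assumes sub: "\<Delta> \<subseteq> linear_forms" and subspace: "mpoly.subspace \<Delta>"
begin

lemma minor_entry_zero:
  assumes "b \<in> linear_forms" "c \<in> linear_forms" "a * d - c * b \<in> ideal_span \<Delta>"
    and "a \<in> \<Delta>" "b \<notin> \<Delta>"
  shows "c \<in> \<Delta>"
proof -
  have "a * d - (a * d - c * b) \<in> ideal_span \<Delta>"
    using assms(4) by (intro ideal_span_diff[OF ideal_span_mult_right assms(3)] ideal_span_base)
  then have "c * b \<in> ideal_span \<Delta>" by simp
  then show ?thesis using linear_ideal_prime[OF sub subspace] assms by blast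
qed

text \<open>
  Modulo \<open>(\<Delta>)\<close>, substituting \<open>b = \<alpha>a\<close> in the minor gives \<open>a(d - \<alpha>c) = 0\<close>.
\<close>

lemma minor_row_multiple:
  assumes "a \<in> linear_forms" "c \<in> linear_forms" "d \<in> linear_forms"
    and "a * d - c * b \<in> ideal_span \<Delta>" "a \<notin> \<Delta>" "b - pscale \<alpha> a \<in> \<Delta>"
  shows "d - pscale \<alpha> c \<in> \<Delta>"
proof -
  have "(a * d - c * b) + c * (b - pscale \<alpha> a) \<in> ideal_span \<Delta>"
    using assms(6) by (intro ideal_span_add[OF assms(4)] ideal_span_mult ideal_span_base)
  also have "(a * d - c * b) + c * (b - pscale \<alpha> a) = a * (d - pscale \<alpha> c)"
    by (simp add: algebra_simps pscale_mult)
  finally show ?thesis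
    using linear_ideal_prime[OF sub subspace] assms diff_linear_forms pscale_linear_forms by blast
qed

text \<open>
  Here \<open>a\<close> divides \<open>cb\<close> modulo \<open>(\<Delta>)\<close>, that is, \<open>cb\<close> lies in the linear ideal of \<open>\<Delta> + Ka\<close>. This
  ideal is prime too, so \<open>a\<close> divides \<open>b\<close> or \<open>c\<close>, and the quotient is a scalar. If it is \<open>c\<close>, then
  \<open>(a, c)\<close> has proportional entries and the previous lemma applies to the transposed minor.
\<close>

lemma minor_proportional:
  assumes lin: "a \<in> linear_forms" "b \<in> linear_forms" "c \<in> linear_forms" "d \<in> linear_forms"
    and minor: "a * d - c * b \<in> ideal_span \<Delta>" and a: "a \<notin> \<Delta>"
  shows "(\<exists>\<alpha>. b - pscale \<alpha> a \<in> \<Delta>) \<or> (\<exists>\<mu>. c - pscale \<mu> a \<in> \<Delta> \<and> d - pscale \<mu> b \<in> \<Delta>)"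
proof -
  let ?\<Delta>' = "mpoly.span (insert a \<Delta>)"
  have mem: "v \<in> ?\<Delta>' \<longleftrightarrow> (\<exists>k. v - pscale k a \<in> \<Delta>)" for v
    using subspace by (simp add: mpoly.span_breakdown_eq mpoly.span_eq_iff[THEN iffD2])
  have "?\<Delta>' \<subseteq> linear_forms"
    using lin(1) sub unfolding linear_forms_def
    by (intro mpoly.span_minimal mpoly.subspace_span) auto
  moreover have "c * b \<in> ideal_span ?\<Delta>'"
  proof -
    have "a * d - (a * d - c * b) \<in> ideal_span ?\<Delta>'"
    proof (rule ideal_span_diff[OF ideal_span_mult_right])
      show "a \<in> ideal_span ?\<Delta>'"
        by (intro ideal_span_base mpoly.span_base) simp
      show "a * d - c * b \<in> ideal_span ?\<Delta>'"
        using minor ideal_span_mono[of \<Delta> ?\<Delta>'] mpoly.span_superset[of "insert a \<Delta>"] by auto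
    qed
    then show ?thesis by simp
  qed
  ultimately have "c \<in> ?\<Delta>' \<or> b \<in> ?\<Delta>'"
    using linear_ideal_prime[OF _ mpoly.subspace_span] lin by blast
  then show ?thesis
  proof
    assume "c \<in> ?\<Delta>'"
    then obtain \<mu> where \<mu>: "c - pscale \<mu> a \<in> \<Delta>" using mem by blast
    have "a * d - b * c \<in> ideal_span \<Delta>" using minor by (simp add: mult.commute)
    then have "d - pscale \<mu> b \<in> \<Delta>" using minor_row_multiple lin a \<mu> by blast
    with \<mu> show ?thesis by blast
  qed (use mem in blast)
qed

end

section \<open>Columns of a scroll matrix\<close>

text \<open>
  The positions of the columns do not matter for the rank, and as a set of pairs the columns
  behave well when blocks are deleted.
\<close>

definition column_set :: "'a list list \<Rightarrow> ('a \<times> 'a) set"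
  where "column_set Bs = (\<Union>B\<in>set Bs. {(B ! j, B ! Suc j) | j. Suc j < length B})"

lemma zip_rows:
  "zip (first_row Bs) (second_row Bs) = concat (map (\<lambda>B. zip (butlast B) (tl B)) Bs)"
  by (induction Bs) (simp_all add: first_row_def second_row_def)

lemma length_rows: "length (second_row Bs) = length (first_row Bs)"
  by (induction Bs) (simp_all add: first_row_def second_row_def)

lemma set_zip_butlast_tl:
  "set (zip (butlast B) (tl B)) = {(B ! j, B ! Suc j) | j. Suc j < length B}"
proof -
  have "zip (butlast B) (tl B) = map (\<lambda>j. (B ! j, B ! Suc j)) [0..<length B - 1]"
    by (rule nth_equalityI) (simp_all add: nth_butlast nth_tl)
  then show ?thesis by (auto simp: less_diff_conv)
qed

lemma column_set_eq: "column_set Bs = set (zip (first_row Bs) (second_row Bs))"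
  by (simp only: zip_rows set_concat set_map column_set_def set_zip_butlast_tl image_image)

lemma set_first_row: "set (first_row Bs) = fst ` column_set Bs"
  by (metis column_set_eq length_rows map_fst_zip set_map)

lemma set_second_row: "set (second_row Bs) = snd ` column_set Bs"
  by (metis column_set_eq length_rows map_snd_zip set_map)

lemma column_minor_in_ideal:
  assumes "(a, b) \<in> column_set Bs" "(c, d) \<in> column_set Bs"
  shows "a * d - c * b \<in> ideal_span (minors Bs)"
proof -
  let ?u = "first_row Bs" and ?v = "second_row Bs"
  obtain j k where j: "j < columns Bs" "a = ?u ! j" "b = ?v ! j"
    and k: "k < columns Bs" "c = ?u ! k" "d = ?v ! k"
    using assms by (auto simp: column_set_eq set_zip columns_def)
  have minor: "?u ! i * ?v ! l - ?u ! l * ?v ! i \<in> ideal_span (minors Bs)"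
    if "i < l" "l < columns Bs" for i l
    using that by (intro ideal_span_base) (auto simp: minors_def)
  consider "j < k" | "j = k" | "k < j" by linarith
  then show ?thesis
  proof cases
    case 1
    then show ?thesis using minor j k by simp
  next
    case 2
    then show ?thesis using j k by (simp add: ideal_span_zero)
  next
    case 3
    then have "0 - (c * b - a * d) \<in> ideal_span (minors Bs)"
      using minor[of k j] j k by (intro ideal_span_diff[OF ideal_span_zero]) simp
    then show ?thesis by simp
  qed
qed

lemma set_delete_block: "set (delete_block i Bs) \<subseteq> set Bs"
  by (auto simp: delete_block_def dest: in_set_takeD in_set_dropD)

lemma column_set_delete_block: "column_set (delete_block i Bs) \<subseteq> column_set Bs"
  unfolding column_set_def using set_delete_block by (rule UN_mono) simp

lemma length_delete_block: "i < length Bs \<Longrightarrow> length (delete_block i Bs) = length Bs - 1"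
  by (simp add: delete_block_def)

lemma columns_delete_block:
  assumes "i < length Bs"
  shows "columns Bs = columns (delete_block i Bs) + (length (Bs ! i) - 1)"
proof -
  have "columns Bs = columns (take i Bs @ Bs ! i # drop (Suc i) Bs)"
    using id_take_nth_drop[OF assms] by simp
  then show ?thesis by (simp add: columns_def first_row_def delete_block_def)
qed

lemma scroll_matrix_delete_block:
  assumes "scroll_matrix Bs"
  shows "scroll_matrix (delete_block i Bs)"
proof -
  have sub: "set (concat (delete_block i Bs)) \<subseteq> set (concat Bs)"
    using set_delete_block[of i Bs] by auto
  have "distinct (concat (delete_block i Bs))"
  proof (cases "i < length Bs")
    case True
    have "concat Bs = concat (take i Bs) @ Bs ! i @ concat (drop (Suc i) Bs)"
      using arg_cong[OF id_take_nth_drop[OF True], of concat] by simp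
    then show ?thesis using assms by (auto simp: scroll_matrix_def delete_block_def)
  qed (use assms in \<open>simp add: scroll_matrix_def delete_block_def\<close>)
  then show ?thesis
    using assms sub set_delete_block[of i Bs] mpoly.independent_mono[OF _ sub]
    unfolding scroll_matrix_def by blast
qed

section \<open>The alternatives\<close>

context linear_ideal
begin

definition rank_one :: "('x, 'k) mpoly list list \<Rightarrow> bool"
  where "rank_one Bs \<longleftrightarrow> (\<forall>(a, b)\<in>column_set Bs. \<forall>(c, d)\<in>column_set Bs.
    a * d - c * b \<in> ideal_span \<Delta>)"

lemma rank_one_minor:
  assumes "rank_one Bs" "B \<in> set Bs" "Suc j < length B" "B' \<in> set Bs" "Suc k < length B'"
  shows "B ! j * B' ! Suc k - B' ! k * B ! Suc j \<in> ideal_span \<Delta>"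
proof -
  have "(B ! j, B ! Suc j) \<in> column_set Bs" "(B' ! k, B' ! Suc k) \<in> column_set Bs"
    using assms unfolding column_set_def by blast+
  with assms(1) show ?thesis unfolding rank_one_def by blast
qed

lemma rank_one_delete_block: "rank_one Bs \<Longrightarrow> rank_one (delete_block i Bs)"
  using column_set_delete_block[of i Bs] unfolding rank_one_def by blast

lemma scroll_entry:
  assumes "scroll_matrix Bs" "B \<in> set Bs" "j < length B"
  shows "B ! j \<in> linear_forms"
  using assms nth_mem[of j B] by (force simp: scroll_matrix_def)

text \<open>
  When no entry vanishes modulo \<open>\<Delta>\<close>, all columns are compared with the first one, \<open>(a, b)\<close>: the
  two rows are proportional if \<open>b\<close> is a multiple of \<open>a\<close>, and otherwise every column is a multiple
  of \<open>(a, b)\<close>.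
\<close>

lemma generic_rank_one_alternatives:
  assumes "generic_matrix Bs" "rank_one Bs" "Bs \<noteq> []"
  shows "generic_alternatives \<Delta> Bs"
  using assms
proof (induction "length Bs" arbitrary: Bs rule: less_induct)
  case less
  have len: "length (Bs ! i) = 2" if "i < length Bs" for i
    using less.prems(1) that by (simp add: generic_matrix_def generic_block_def)
  have lin: "Bs ! i ! 0 \<in> linear_forms" "Bs ! i ! 1 \<in> linear_forms" if "i < length Bs" for i
    using less.prems(1) that len[OF that] scroll_entry[of Bs "Bs ! i"]
    by (auto simp: generic_matrix_def)
  have minor: "Bs ! i ! 0 * Bs ! k ! 1 - Bs ! k ! 0 * Bs ! i ! 1 \<in> ideal_span \<Delta>"
    if "i < length Bs" "k < length Bs" for i k
    using rank_one_minor[OF less.prems(2) nth_mem[OF that(1)] _ nth_mem[OF that(2)], of 0 0]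
      len that by simp
  show ?case
  proof (cases "\<exists>i<length Bs. Bs ! i ! 0 \<in> \<Delta> \<and> Bs ! i ! 1 \<in> \<Delta>")
    case True
    then obtain i where i: "i < length Bs" "Bs ! i ! 0 \<in> \<Delta>" "Bs ! i ! 1 \<in> \<Delta>" by blast
    let ?D = "delete_block i Bs"
    have gen: "generic_matrix ?D"
      using less.prems(1) scroll_matrix_delete_block set_delete_block[of i Bs]
      unfolding generic_matrix_def by blast
    have cols: "columns ?D = columns Bs - 1"
      using columns_delete_block[OF i(1)] len[OF i(1)] by simp
    have "generic_alternatives \<Delta> ?D" if "columns ?D \<ge> 2"
    proof (rule less.hyps)
      show "length ?D < length Bs" using i(1) by (simp add: length_delete_block)
      show "?D \<noteq> []" using that by (auto simp: columns_def first_row_def)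
    qed (use gen less.prems(2) rank_one_delete_block in auto)
    then show ?thesis using generic_alternatives.column_in i gen cols by blast
  next
    case no_zero: False
    consider (first) "\<exists>i<length Bs. Bs ! i ! 0 \<in> \<Delta>" | (second) "\<exists>i<length Bs. Bs ! i ! 1 \<in> \<Delta>"
      | (none) "\<forall>i<length Bs. Bs ! i ! 0 \<notin> \<Delta> \<and> Bs ! i ! 1 \<notin> \<Delta>" by blast
    then show ?thesis
    proof cases
      case first
      then obtain i where i: "i < length Bs" "Bs ! i ! 0 \<in> \<Delta>" "Bs ! i ! 1 \<notin> \<Delta>"
        using no_zero by blast
      then have "\<forall>k<length Bs. Bs ! k ! 0 \<in> \<Delta>"
        using minor_entry_zero[OF lin(2) lin(1) minor] by blast
      with i show ?thesis using generic_alternatives.line_in[of Bs Bs] by blast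
    next
      case second
      then obtain i where i: "i < length Bs" "Bs ! i ! 1 \<in> \<Delta>" "Bs ! i ! 0 \<notin> \<Delta>"
        using no_zero by blast
      have all: "Bs ! k ! 1 \<in> \<Delta>" if k: "k < length Bs" for k
      proof -
        have "Bs ! i ! 1 * Bs ! k ! 0 - Bs ! k ! 1 * Bs ! i ! 0 \<in> ideal_span \<Delta>"
          using minor[OF k i(1)] by (simp add: mult.commute)
        then show ?thesis using minor_entry_zero[OF lin(1)[OF i(1)] lin(2)[OF k]] i by blast
      qed
      have rev: "map rev Bs ! k ! 0 = Bs ! k ! 1" "map rev Bs ! k ! 1 = Bs ! k ! 0"
        if "k < length Bs" for k
        using that len[OF that] by (simp_all add: rev_nth)
      show ?thesis
      proof (rule generic_alternatives.line_in)
        show "map rev Bs = Bs \<or> map rev Bs = map rev Bs" by simp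
        show "\<exists>i<length (map rev Bs). map rev Bs ! i ! 0 \<in> \<Delta> \<and> map rev Bs ! i ! 1 \<notin> \<Delta>"
          using i rev by auto
        show "\<forall>i<length (map rev Bs). map rev Bs ! i ! 0 \<in> \<Delta>"
          using all rev by auto
      qed
    next
      case none
      have 0: "0 < length Bs" using less.prems(3) by simp
      show ?thesis
      proof (cases "\<exists>\<alpha>. Bs ! 0 ! 1 - pscale \<alpha> (Bs ! 0 ! 0) \<in> \<Delta>")
        case True
        then obtain \<alpha> where \<alpha>: "Bs ! 0 ! 1 - pscale \<alpha> (Bs ! 0 ! 0) \<in> \<Delta>" by blast
        then have "\<alpha> \<noteq> 0" using none 0 by auto
        moreover have "Bs ! i ! 1 - pscale \<alpha> (Bs ! i ! 0) \<in> \<Delta>" if "i < length Bs" for i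
          using minor_row_multiple[OF lin(1)[OF 0] lin(1,2)[OF that] minor[OF 0 that] _ \<alpha>] none 0
          by blast
        moreover have "0 \<in> \<Delta>" using subspace by (rule mpoly.subspace_0)
        ultimately have "Bs ! i ! 0 \<in> linear_forms \<and> Bs ! i ! 0 \<noteq> 0 \<and> Bs ! i ! 0 \<notin> \<Delta> \<and>
            {Bs ! i ! 0 - Bs ! i ! 0, Bs ! i ! 1 - pscale \<alpha> (Bs ! i ! 0)} \<subseteq> \<Delta>"
          if "i < length Bs" for i
          using none lin(1) that by auto
        then show ?thesis
          using generic_alternatives.proportional_rows[OF \<open>\<alpha> \<noteq> 0\<close>, of Bs \<Delta>] by blast
      next
        case False
        have "\<exists>\<mu>. \<mu> \<noteq> 0 \<and> {Bs ! i ! 0 - pscale \<mu> (Bs ! 0 ! 0), Bs ! i ! 1 - pscale \<mu> (Bs ! 0 ! 1)} \<subseteq> \<Delta>"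
          if i: "i < length Bs" for i
        proof -
          obtain \<mu> where \<mu>: "Bs ! i ! 0 - pscale \<mu> (Bs ! 0 ! 0) \<in> \<Delta>"
              "Bs ! i ! 1 - pscale \<mu> (Bs ! 0 ! 1) \<in> \<Delta>"
            using minor_proportional[OF lin[OF 0] lin[OF i] minor[OF 0 i]] False none 0 by blast
          moreover have "\<mu> \<noteq> 0" using \<mu>(1) none i by auto
          ultimately show ?thesis by blast
        qed
        then show ?thesis
          using generic_alternatives.proportional_columns[OF lin[OF 0], of \<Delta> Bs] none 0 by blast
      qed
    qed
  qed
qed

text \<open>
  Overlapping columns turn a common ratio of the rows into a geometric progression along the
  block.
\<close>

lemma block_geometric:
  assumes "\<And>j. Suc j < length B \<Longrightarrow> B ! Suc j - pscale \<alpha> (B ! j) \<in> \<Delta>" "j < length B"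
  shows "B ! j - pscale (\<alpha> ^ j) (B ! 0) \<in> \<Delta>"
  using assms(2)
proof (induction j)
  case 0
  then show ?case using mpoly.subspace_0[OF subspace] by simp
next
  case (Suc j)
  have "(B ! Suc j - pscale \<alpha> (B ! j)) + pscale \<alpha> (B ! j - pscale (\<alpha> ^ j) (B ! 0)) \<in> \<Delta>"
    using Suc assms(1) subspace by (intro mpoly.subspace_add mpoly.subspace_scale) auto
  then show ?case by (simp add: mpoly.scale_right_diff_distrib)
qed

text \<open>
  Applied to membership in \<open>\<Delta>\<close>, this finds in a partly vanishing block a column with exactly one
  vanishing entry.
\<close>

lemma adjacent_change:
  assumes "\<exists>L\<in>set B. P L" "\<exists>L\<in>set B. \<not> P L"
  shows "\<exists>m. Suc m < length B \<and> P (B ! m) \<noteq> P (B ! Suc m)"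
proof (rule ccontr)
  assume no: "\<not> ?thesis"
  have "P (B ! j) = P (B ! 0)" if "j < length B" for j
    using that
  proof (induction j)
    case (Suc j)
    then show ?case using no Suc_lessD by blast
  qed simp
  then show False using assms unfolding in_set_conv_nth Bex_def by blast
qed

text \<open>
  A block that meets \<open>\<Delta>\<close> without being contained in it has a column with exactly one entry in
  \<open>\<Delta>\<close>, which forces one row of the whole matrix into \<open>\<Delta>\<close> and keeps the other out. Apart from
  that case, from non generic blocks inside \<open>\<Delta>\<close>, and from generic matrices, the ratio \<open>\<alpha>\<close> found
  in one non generic block governs all columns.
\<close>

lemma scroll_rank_one_alternatives:
  assumes "scroll_matrix Bs" "rank_one Bs"
  shows "scroll_alternatives \<Delta> Bs"
  using assms
proof (induction "length Bs" arbitrary: Bs rule: less_induct)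
  case less
  note minor = rank_one_minor[OF less.prems(2)]
  note entry = scroll_entry[OF less.prems(1)]
  have "generic_block B \<or> nongeneric_block B" if "B \<in> set Bs" for B
    using less.prems(1) that
    by (auto simp: scroll_matrix_def generic_block_def nongeneric_block_def)
  then consider (generic) "\<forall>B\<in>set Bs. generic_block B"
    | (inside) B where "B \<in> set Bs" "nongeneric_block B" "\<forall>L\<in>set B. L \<in> \<Delta>"
    | (mixed) B where "B \<in> set Bs" "\<exists>L\<in>set B. L \<in> \<Delta>" "\<exists>L\<in>set B. L \<notin> \<Delta>"
    | (outside) "\<exists>B\<in>set Bs. nongeneric_block B"
        "\<forall>B\<in>set Bs. nongeneric_block B \<longrightarrow> (\<forall>L\<in>set B. L \<notin> \<Delta>)"
    by blast
  then show ?case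
  proof cases
    case generic
    then have "generic_matrix Bs" using less.prems(1) by (simp add: generic_matrix_def)
    moreover have "Bs \<noteq> []" if "columns Bs \<ge> 2"
      using that by (auto simp: columns_def first_row_def)
    ultimately show ?thesis
      using generic generic_rank_one_alternatives less.prems(2)
        scroll_alternatives.all_generic[of Bs \<Delta>] by blast
  next
    case inside
    then obtain i where i: "i < length Bs" "nongeneric_block (Bs ! i)" "set (Bs ! i) \<subseteq> \<Delta>"
      by (auto simp: in_set_conv_nth)
    let ?D = "delete_block i Bs"
    have "scroll_matrix ?D" using less.prems(1) by (rule scroll_matrix_delete_block)
    moreover have "columns ?D < columns Bs"
      using columns_delete_block[OF i(1)] i(2) by (simp add: nongeneric_block_def)
    moreover have "scroll_alternatives \<Delta> ?D"
      using less.hyps[of ?D] length_delete_block[OF i(1)] i(1) calculation(1)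
        rank_one_delete_block[OF less.prems(2)] by simp
    ultimately show ?thesis using scroll_alternatives.block_in i by blast
  next
    case mixed
    then obtain m where m: "Suc m < length B" "(B ! m \<in> \<Delta>) \<noteq> (B ! Suc m \<in> \<Delta>)"
      using adjacent_change[where P = "\<lambda>L. L \<in> \<Delta>" and B = B] by blast
    note B = mixed(1) m(1) and m = m(2)
    have col: "(B ! m, B ! Suc m) \<in> column_set Bs" using B unfolding column_set_def by blast
    have lin: "B ! m \<in> linear_forms" "B ! Suc m \<in> linear_forms" using entry B by auto
    show ?thesis
    proof (rule scroll_alternatives.one_line_in, cases "B ! m \<in> \<Delta>")
      case True
      have "c \<in> \<Delta>" if cd: "(c, d) \<in> column_set Bs" for c d
      proof -
        obtain B' k where B': "B' \<in> set Bs" "Suc k < length B'" "c = B' ! k" "d = B' ! Suc k"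
          using cd unfolding column_set_def by blast
        show ?thesis
          using minor_entry_zero[OF lin(2) _ minor[OF B B'(1,2)]] True m entry B' by auto
      qed
      then have "set (first_row Bs) \<subseteq> \<Delta>" by (auto simp: set_first_row)
      moreover have "B ! Suc m \<in> set (second_row Bs)"
        using image_eqI[OF _ col, of _ snd] by (simp add: set_second_row)
      ultimately show "(set (first_row Bs) \<subseteq> \<Delta>) \<noteq> (set (second_row Bs) \<subseteq> \<Delta>)"
        using True m by blast
    next
      case False
      have "d \<in> \<Delta>" if cd: "(c, d) \<in> column_set Bs" for c d
      proof -
        obtain B' k where B': "B' \<in> set Bs" "Suc k < length B'" "c = B' ! k" "d = B' ! Suc k"
          using cd unfolding column_set_def by blast
        have "B ! Suc m * c - d * B ! m \<in> ideal_span \<Delta>"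
          using minor[OF B'(1,2) B] B'(3,4) by (simp add: mult.commute)
        then show ?thesis
          using minor_entry_zero[OF lin(1)] False m entry B' by auto
      qed
      then have "set (second_row Bs) \<subseteq> \<Delta>" by (auto simp: set_second_row)
      moreover have "B ! m \<in> set (first_row Bs)"
        using image_eqI[OF _ col, of _ fst] by (simp add: set_first_row)
      ultimately show "(set (first_row Bs) \<subseteq> \<Delta>) \<noteq> (set (second_row Bs) \<subseteq> \<Delta>)"
        using False by blast
    qed
  next
    case outside
    then obtain B where B: "B \<in> set Bs" "length B > 2" by (auto simp: nongeneric_block_def)
    have "B ! j \<notin> \<Delta>" if "j < length B" for j
      using outside(2) B that by (simp add: nongeneric_block_def)
    with B(2) have out: "B ! 0 \<notin> \<Delta>" "B ! 1 \<notin> \<Delta>"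
      using order_less_trans[of 0 2 "length B"] by simp_all
    have lin: "B ! 0 \<in> linear_forms" "B ! 1 \<in> linear_forms" "B ! 2 \<in> linear_forms"
      using B(2) by (auto intro!: entry[OF B(1)])
    have "B ! 0 * B ! 2 - B ! 1 * B ! 1 \<in> ideal_span \<Delta>"
      using minor[OF B(1) _ B(1), of 0 1] B(2) by (simp add: numeral_2_eq_2)
    \<comment> \<open>The columns \<open>(L\<^sub>0, L\<^sub>1)\<close> and \<open>(L\<^sub>1, L\<^sub>2)\<close> share \<open>L\<^sub>1\<close>, so both outcomes of
      \<open>minor_proportional\<close> make it a multiple of \<open>L\<^sub>0\<close>.\<close>
    then obtain \<alpha> where \<alpha>: "B ! 1 - pscale \<alpha> (B ! 0) \<in> \<Delta>"
      using minor_proportional[OF lin(1,2,2,3)] out(1) by blast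
    have "\<alpha> \<noteq> 0" using \<alpha> out(2) by auto
    have ratio: "B' ! Suc k - pscale \<alpha> (B' ! k) \<in> \<Delta>" if "B' \<in> set Bs" "Suc k < length B'" for B' k
      using minor_row_multiple[OF lin(1) entry[OF that(1)] entry[OF that]
          minor[OF B(1) _ that, of 0] out(1)] \<alpha> B(2) that(2) by simp
    show ?thesis
    proof (rule scroll_alternatives.no_nongeneric_entry_in[OF outside \<open>\<alpha> \<noteq> 0\<close>])
      show "\<forall>B\<in>set Bs. nongeneric_block B \<longrightarrow>
        (\<exists>H\<in>linear_forms. H \<notin> \<Delta> \<and> (\<forall>j<length B. B ! j - pscale (\<alpha> ^ j) H \<in> \<Delta>))"
      proof (intro ballI impI)
        fix B' assume B': "B' \<in> set Bs" "nongeneric_block B'"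
        then have "0 < length B'" by (auto simp: nongeneric_block_def)
        then have "B' ! 0 \<notin> \<Delta>" "B' ! 0 \<in> linear_forms"
          using outside(2) B' entry nth_mem by blast+
        then show "\<exists>H\<in>linear_forms. H \<notin> \<Delta> \<and> (\<forall>j<length B'. B' ! j - pscale (\<alpha> ^ j) H \<in> \<Delta>)"
          using block_geometric[of B' \<alpha>] ratio B'(1) by blast
      qed
      show "\<forall>B\<in>set Bs. generic_block B \<longrightarrow>
        (\<exists>H\<in>linear_forms. (H = 0 \<or> H \<notin> \<Delta>) \<and> {B ! 0 - H, B ! 1 - pscale \<alpha> H} \<subseteq> \<Delta>)"
      proof (intro ballI impI)
        fix B' assume B': "B' \<in> set Bs" "generic_block B'"
        have r: "B' ! 1 - pscale \<alpha> (B' ! 0) \<in> \<Delta>"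
          using ratio[of B' 0] B' by (simp add: generic_block_def)
        have z: "0 \<in> \<Delta>" using subspace by (rule mpoly.subspace_0)
        show "\<exists>H\<in>linear_forms. (H = 0 \<or> H \<notin> \<Delta>) \<and> {B' ! 0 - H, B' ! 1 - pscale \<alpha> H} \<subseteq> \<Delta>"
        \<comment> \<open>A generic column may vanish entirely, which is the case \<open>H = 0\<close>.\<close>
        proof (cases "B' ! 0 \<in> \<Delta>")
          case True
          then have "(B' ! 1 - pscale \<alpha> (B' ! 0)) + pscale \<alpha> (B' ! 0) \<in> \<Delta>"
            using r subspace by (intro mpoly.subspace_add mpoly.subspace_scale)
          then show ?thesis using True z sub by (intro bexI[of _ 0]) auto
        next
          case False
          then show ?thesis
            using r z entry B' by (intro bexI[of _ "B' ! 0"]) (auto simp: generic_block_def)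
        qed
      qed
    qed
  qed
qed

end

theorem proposition1:
  fixes Bs :: "('x::finite, 'k::field) mpoly list list"
    and \<Delta> :: "('x, 'k) mpoly set"
  assumes "scroll_matrix Bs"
    and "\<Delta> \<subseteq> linear_forms" and "mpoly.subspace \<Delta>"
    and "ideal_span (minors Bs) \<subseteq> ideal_span \<Delta>"
  shows "scroll_alternatives \<Delta> Bs"
proof -
  interpret linear_ideal \<Delta> using assms by unfold_locales
  have "rank_one Bs"
    using column_minor_in_ideal assms(4) unfolding rank_one_def by fast
  with assms(1) show ?thesis by (rule scroll_rank_one_alternatives)
qed

end
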